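(* Let $\tilde{X} = [\tilde{X}_1, \dots, \tilde{X}_d]^\top \in \mathbb{C}^d$ be a complex-valued input vector. Then the following two statements hold. (1) (Complex linear projection) Let $W \in \mathbb{C}^d$. Then the standard complex projection $\tilde{Y}_{\text{complex}} = W^\top \tilde{X}$ can represent any complex value; that is, for every $z \in \mathbb{C}$ there exists $W \in \mathbb{C}^d$ such that $W^\top \tilde{X} = z$. (2) (ReIm Block) Let $W_r \in \mathbb{R}^d$. The projection $\tilde{Y}_{\text{real}} = W_r^\top \tilde{X}$ can represent any complex number in $\mathbb{C}$ (that is, for every $z \in \mathbb{C}$ there exists $W_r \in \mathbb{R}^d$ such that $W_r^\top \tilde{X} = z$) if and only if there exist at least two entries $\tilde{X}_i, \tilde{X}_j$ of $\tilde{X}$ whose phase difference satisfies $\arg(\tilde{X}_i) - \arg(\tilde{X}_j) \notin \pi \mathbb{Z}$. That is, the input contains at least two linearly independent directions in the complex plane (regarded as a two-dimensional real vector space).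
   Context: For vectors $W, \tilde{X} \in \mathbb{C}^d$, $W^\top \tilde{X} = \sum_{i=1}^d W_i \tilde{X}_i$ (no complex conjugation). The argument (phase) $\arg(z)$ is defined, modulo $2\pi$, for nonzero complex $z$, so the phase condition refers to entries whose argument is defined; whether a difference of arguments lies in $\pi\mathbb{Z} = \{\pi n : n \in \mathbb{Z}\}$ does not depend on the choice of arguments. Saying that a projection "can represent any complex number" means that, for the given input $\tilde{X}$, every complex number is attained as the output for some choice of the weight vector ($W$ ranging over $\mathbb{C}^d$ in (1), $W_r$ ranging over $\mathbb{R}^d$ in (2)).
   Formalization: Part (1) is stated only for nonzero input vectors, since for the zero input every output is 0 and no nonzero complex value can be represented; part (2) is stated for every input. *)

theory Defs
  imports "HOL-Analysis.Analysis"
begin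

text \<open>
  \<^const>\<open>scalar_product\<close> is the bilinear product on \<open>\<complex>\<^sup>d\<close>, without complex conjugation
  (unlike the inner product of the library), so it is \<open>W\<^sup>T X\<close>.
\<close>

definition complex_projection :: "complex ^ 'd \<Rightarrow> complex ^ 'd \<Rightarrow> complex" where
  "complex_projection W X = scalar_product W X"

definition reim_projection :: "real ^ 'd \<Rightarrow> complex ^ 'd \<Rightarrow> complex" where
  "reim_projection W\<^sub>r X = scalar_product (\<chi> i. complex_of_real (W\<^sub>r $ i)) X"

text \<open>
  The library sets \<open>Arg 0 = 0\<close> by convention; the argument of zero is undefined here, hence
  the two conditions that the entries are nonzero. Using the principal branch is harmless, since a
  change of branch alters the difference by a multiple of \<open>2 * pi\<close>.
\<close>

definition phase_difference_not_multiple_of_pi :: "complex \<Rightarrow> complex \<Rightarrow> bool" where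
  "phase_difference_not_multiple_of_pi x y \<longleftrightarrow>
     x \<noteq> 0 \<and> y \<noteq> 0 \<and> Arg x - Arg y \<notin> {pi * of_int n | n :: int. True}"

end

theory Submission
  imports Defs
begin

text \<open>
  All conditions are read off the real determinant \<open>Im (x * cnj y) = \<bar>x\<bar> \<bar>y\<bar> sin (Arg x - Arg y)\<close>
  of two complex numbers. If it is nonzero for two entries, Cramer's rule represents every
  complex number. If it vanishes for all pairs of entries, then by bilinearity it vanishes for
  all pairs of outputs, so \<open>1\<close> and \<open>\<i>\<close> are not both outputs.
\<close>

text \<open>When an argument is zero both sides are false, so the value of \<open>Arg 0\<close>
  never enters. Otherwise the moduli are positive and only the sine can vanish, which it does
  exactly at integer multiples of pi.\<close>

lemma phase_difference_not_multiple_of_pi_iff: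
  "phase_difference_not_multiple_of_pi x y \<longleftrightarrow> Im (x * cnj y) \<noteq> 0"
proof (cases "x = 0 \<or> y = 0")
  case True
  then show ?thesis by (auto simp: phase_difference_not_multiple_of_pi_def)
next
  case False
  have "x * cnj y = rcis (cmod x) (Arg x) * cnj (rcis (cmod y) (Arg y))"
    by (simp add: rcis_cmod_Arg)
  also have "\<dots> = rcis (cmod x * cmod y) (Arg x - Arg y)"
    by (simp add: rcis_def cis_cnj cis_divide[symmetric] divide_inverse)
  finally have "Im (x * cnj y) = cmod x * cmod y * sin (Arg x - Arg y)"
    by simp
  then show ?thesis
    using False by (auto simp: phase_difference_not_multiple_of_pi_def sin_zero_iff_int2 mult.commute)
qed

text \<open>If z = a x + b y with real a and b, then \<open>Im (z * cnj y)\<close> loses the y term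
  and \<open>Im (x * cnj z)\<close> loses the x term, because \<open>w * cnj w\<close> is real. This
  yields the two coefficients.\<close>

lemma complex_cramer:
  assumes "Im (x * cnj y) \<noteq> 0"
  shows "z = of_real (Im (z * cnj y) / Im (x * cnj y)) * x
    + of_real (Im (x * cnj z) / Im (x * cnj y)) * y"
  using assms by (simp add: complex_eq_iff divide_simps) (simp add: algebra_simps)

text \<open>The conjunct \<open>x \<noteq> y\<close> excludes the collapse of \<open>{x, y}\<close>
  to a singleton, which would be independent for every nonzero x.\<close>

lemma independent_pair_iff_Im:
  "x \<noteq> y \<and> independent {x, y} \<longleftrightarrow> Im (x * cnj y) \<noteq> 0"
proof (cases "y = 0")
  case True
  then show ?thesis by (auto simp: dependent_zero)
next
  case False
  have "x \<in> span {y} \<longleftrightarrow> Im (x * cnj y) = 0"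
  proof
    assume "Im (x * cnj y) = 0"
    \<comment> \<open>The quotient x / y equals \<open>x * cnj y\<close> divided by the squared
      modulus of y, so it is real here and x is a real multiple of y.\<close>
    then have "x * cnj y = of_real (Re (x * cnj y))"
      by (simp add: complex_eq_iff)
    moreover have "x = x * cnj y / (y * cnj y) * y"
      using False by (simp add: field_simps)
    moreover have "y * cnj y = of_real ((cmod y)\<^sup>2)"
      by (simp only: complex_norm_square)
    ultimately have "x = (Re (x * cnj y) / (cmod y)\<^sup>2) *\<^sub>R y"
      by (metis of_real_divide scaleR_conv_of_real)
    then show "x \<in> span {y}"
      by (metis span_base span_scale singletonI)
  qed (auto simp: span_singleton)
  moreover have "independent {y}"
    using False by simp
  ultimately show ?thesis
    using span_base[of x "{y}"] by (auto simp: independent_insert)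
qed

text \<open>A complex weight on one nonzero entry can both rotate and scale it to z. For
  \<open>X = 0\<close> the only output is 0, hence the assumption.\<close>

lemma complex_projection_surj:
  assumes "X \<noteq> 0"
  shows "\<exists>W. complex_projection W X = z"
proof -
  obtain i where i: "X $ i \<noteq> 0"
    using assms by (auto simp: vec_eq_iff)
  have "complex_projection (axis i (z / X $ i)) X = z"
    using i by (simp add: complex_projection_def scalar_product_def axis_def if_distrib
        [where f = "\<lambda>w. w * _"] cong: if_cong)
  then show ?thesis ..
qed

lemma reim_projection_eq_sum: "reim_projection W X = (\<Sum>i\<in>UNIV. of_real (W $ i) * X $ i)"
  by (simp add: reim_projection_def scalar_product_def)

text \<open>Real weights are fixed by \<open>cnj\<close> and pass through \<open>Im\<close>, so the
  determinant expands bilinearly.\<close>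

lemma Im_reim_projection_mult_cnj:
  "Im (reim_projection V X * cnj (reim_projection W X))
    = (\<Sum>i\<in>UNIV. \<Sum>j\<in>UNIV. V $ i * W $ j * Im (X $ i * cnj (X $ j)))"
proof -
  have "reim_projection V X * cnj (reim_projection W X)
      = (\<Sum>i\<in>UNIV. \<Sum>j\<in>UNIV. of_real (V $ i * W $ j) * (X $ i * cnj (X $ j)))"
    by (simp add: reim_projection_eq_sum sum_product mult_ac)
  then show ?thesis
    by (simp add: sum_distrib_left)
qed

lemma reim_projection_surj_iff:
  "(\<forall>z. \<exists>W. reim_projection W X = z) \<longleftrightarrow> (\<exists>i j. Im (X $ i * cnj (X $ j)) \<noteq> 0)"
proof
  assume surj: "\<forall>z. \<exists>W. reim_projection W X = z"
  \<comment> \<open>These two outputs have determinant 1, so some term of the double sum is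
    nonzero.\<close>
  obtain V W where "reim_projection V X = \<i>" "reim_projection W X = 1"
    using surj by meson
  then have "(\<Sum>i\<in>UNIV. \<Sum>j\<in>UNIV. V $ i * W $ j * Im (X $ i * cnj (X $ j))) \<noteq> 0"
    using Im_reim_projection_mult_cnj[of V X W] by simp
  then show "\<exists>i j. Im (X $ i * cnj (X $ j)) \<noteq> 0"
    by (metis (no_types, lifting) mult_zero_right sum.neutral)
next
  assume "\<exists>i j. Im (X $ i * cnj (X $ j)) \<noteq> 0"
  then obtain i j where ij: "Im (X $ i * cnj (X $ j)) \<noteq> 0"
    by blast
  show "\<forall>z. \<exists>W. reim_projection W X = z"
  proof
    fix z
    \<comment> \<open>Weights supported on the entries i and j suffice; Cramer's rule then supplies
      a and b.\<close>
    have axis: "(\<Sum>k\<in>UNIV. of_real (axis i a $ k) * X $ k) = of_real a * X $ i" for i a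
      by (simp add: axis_def if_distrib[where f = "\<lambda>w. of_real w * _"] cong: if_cong)
    have "reim_projection (axis i a + axis j b) X = of_real a * X $ i + of_real b * X $ j" for a b
      by (simp add: reim_projection_eq_sum distrib_right sum.distrib axis)
    then show "\<exists>W. reim_projection W X = z"
      using complex_cramer[OF ij, of z] by metis
  qed
qed

theorem theorem2:
  fixes X :: "complex ^ 'd"
  shows "(X \<noteq> 0 \<longrightarrow> (\<forall>z. \<exists>W :: complex ^ 'd. complex_projection W X = z)) \<and>
    ((\<forall>z. \<exists>W\<^sub>r :: real ^ 'd. reim_projection W\<^sub>r X = z) \<longleftrightarrow>
       (\<exists>i j. i \<noteq> j \<and> phase_difference_not_multiple_of_pi (X $ i) (X $ j))) \<and>
    ((\<exists>i j. i \<noteq> j \<and> phase_difference_not_multiple_of_pi (X $ i) (X $ j)) \<longleftrightarrow>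
       (\<exists>i j. X $ i \<noteq> X $ j \<and> independent {X $ i, X $ j}))"
proof -
  \<comment> \<open>The determinant of an entry with itself is 0, so a nonzero one forces distinct
    indices.\<close>
  have "i \<noteq> j" if "Im (X $ i * cnj (X $ j)) \<noteq> 0" for i j
    using that by auto
  then have "(\<exists>i j. i \<noteq> j \<and> phase_difference_not_multiple_of_pi (X $ i) (X $ j))
      \<longleftrightarrow> (\<exists>i j. Im (X $ i * cnj (X $ j)) \<noteq> 0)"
    unfolding phase_difference_not_multiple_of_pi_iff by blast
  then show ?thesis
    using complex_projection_surj[of X]
    by (simp only: reim_projection_surj_iff independent_pair_iff_Im) simp
qed

end
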